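(* Let $\mathcal{M}$ be either of the closure operators $\mathcal{A}$ (aggregation closure) or $\mathcal{C}$ (Chvátal–Gomory closure). Then for polyhedra that are not required to be packing or covering polyhedra, $1\mathcal{M}$ can be an arbitrarily bad approximation of $\mathcal{M}$: for each $\alpha\ge 0$ there is a polyhedron $P=\{x\in\mathbb{R}^n_+\mid Ax\le b\}$ (with $A,b$ rational of arbitrary sign) such that $1\mathcal{M}(P)$ is not an $\alpha$-approximation of $\mathcal{M}(P)$.
   Context: For a polyhedron $P=\{x\in\mathbb{R}^n_+\mid Ax\le b\}$ with $A\in\mathbb{Q}^{m\times n}$, $b\in\mathbb{Q}^m$, $A^i$ the $i$-th row of $A$: the CG closure is $\mathcal{C}(P)=\{x\in P \mid a^\top x\le\lfloor\beta\rfloor \text{ for all } a\in\mathbb{Z}^n,\beta\in\mathbb{R}\text{ with } a^\top x\le\beta\text{ valid for }P\}$; the aggregation closure is $\mathcal{A}(P)=\bigcap_{\lambda\in\mathbb{R}^m_+}\operatorname{conv}(\{x\in\mathbb{Z}^n_+\mid \lambda^\top Ax\le\lambda^\top b\})$; the 1-row closures are $1\mathcal{C}(P)=\bigcap_{i=1}^m\mathcal{C}(\{x\in\mathbb{R}^n_+\mid A^ix\le b_i\})$ and $1\mathcal{A}(P)=\bigcap_{i=1}^m\mathcal{A}(\{x\in\mathbb{R}^n_+\mid A^ix\le b_i\})$. For $U\supseteq V$, $U$ is an $\alpha$-approximation of $V$ if $\max\{c^\top x\mid x\in U\}\le\alpha\cdot\max\{c^\top x\mid x\in V\}$ for all $c\in\mathbb{R}^n_+$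 (maxima are read as suprema). Here $V$ is understood to be non-empty. *)

theory Defs
  imports "Jordan_Normal_Form.Matrix" "HOL-Library.Extended_Real" "HOL.Hull"
begin

text \<open>Points of $\mathbb{R}^n$ are real vectors in \<^term>\<open>carrier_vec n\<close>, so that the dimension
  can be quantified; the order \<open>\<le>\<close> on vectors is componentwise. A polyhedron is
  always given by a description \<open>(A, b)\<close>, with one row of \<open>A\<close> per constraint.\<close>

abbreviation real_mat :: "rat mat \<Rightarrow> real mat" where
  "real_mat \<equiv> map_mat real_of_rat"

abbreviation real_vec :: "rat vec \<Rightarrow> real vec" where
  "real_vec \<equiv> map_vec real_of_rat"

definition nonneg_orthant :: "nat \<Rightarrow> real vec set" where
  "nonneg_orthant n = {x \<in> carrier_vec n. 0\<^sub>v n \<le> x}"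

definition nonneg_polyhedron :: "rat mat \<Rightarrow> rat vec \<Rightarrow> real vec set" where
  "nonneg_polyhedron A b =
     {x \<in> nonneg_orthant (dim_col A). real_mat A *\<^sub>v x \<le> real_vec b}"

text \<open>The type of vectors is not a \<open>real_vector\<close>; the following repeats
  the library's definition of convexity, and hulls are formed as for
  \<open>convex hull S\<close>.\<close>

definition convex_vec :: "real vec set \<Rightarrow> bool" where
  "convex_vec S \<longleftrightarrow>
     (\<forall>x\<in>S. \<forall>y\<in>S. \<forall>u\<ge>0. \<forall>v\<ge>0. u + v = 1 \<longrightarrow> u \<cdot>\<^sub>v x + v \<cdot>\<^sub>v y \<in> S)"

definition cg_closure_set :: "nat \<Rightarrow> real vec set \<Rightarrow> real vec set" where
  "cg_closure_set n P =
     {x \<in> P. \<forall>a \<in> carrier_vec n. \<forall>\<beta>::real.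
        (\<forall>y\<in>P. map_vec real_of_int a \<bullet> y \<le> \<beta>) \<longrightarrow>
        map_vec real_of_int a \<bullet> x \<le> real_of_int \<lfloor>\<beta>\<rfloor>}"

definition cg_closure :: "rat mat \<Rightarrow> rat vec \<Rightarrow> real vec set" where
  "cg_closure A b = cg_closure_set (dim_col A) (nonneg_polyhedron A b)"

definition aggregation_closure :: "rat mat \<Rightarrow> rat vec \<Rightarrow> real vec set" where
  "aggregation_closure A b =
     (\<Inter>l \<in> nonneg_orthant (dim_row A).
        convex_vec hull {x \<in> nonneg_orthant (dim_col A).
          (\<forall>j < dim_col A. x $ j \<in> \<int>) \<and> l \<bullet> (real_mat A *\<^sub>v x) \<le> l \<bullet> real_vec b})"

text \<open>For a description without rows the intersection is over an empty family; the operator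
  is meant for \<open>dim_row A > 0\<close>.\<close>

definition one_row_closure ::
    "(rat mat \<Rightarrow> rat vec \<Rightarrow> real vec set) \<Rightarrow> rat mat \<Rightarrow> rat vec \<Rightarrow> real vec set" where
  "one_row_closure M A b =
     (\<Inter>i < dim_row A. M (mat_of_row (row A i)) (vec_of_list [b $ i]))"

text \<open>Only meaningful for non-empty \<open>V \<subseteq> U \<subseteq> nonneg_orthant n\<close>. Suprema are taken in the
  extended reals, so unbounded objectives have value \<open>\<infinity>\<close>, where \<open>0 * \<infinity> = 0\<close>.\<close>

definition is_approximation :: "nat \<Rightarrow> real \<Rightarrow> real vec set \<Rightarrow> real vec set \<Rightarrow> bool" where
  "is_approximation n \<alpha> U V \<longleftrightarrow>
     (\<forall>c \<in> nonneg_orthant n.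
        (SUP x\<in>U. ereal (c \<bullet> x)) \<le> ereal \<alpha> * (SUP x\<in>V. ereal (c \<bullet> x)))"

end

theory Submission
  imports Defs
begin

text \<open>Take the two rows \<open>x\<^sub>1 - x\<^sub>2 \<le> 0\<close> and \<open>x\<^sub>1 + x\<^sub>2 \<le> 1\<close>. Each of them alone cuts an integral
  polyhedron out of the orthant, so the point \<open>(1/2, 1/2)\<close> survives in every 1-row closure. Their
  sum \<open>2 x\<^sub>1 \<le> 1\<close> forces \<open>x\<^sub>1 \<le> 0\<close> at integral points, and it rounds to the
  CG cut \<open>x\<^sub>1 \<le> \<lfloor>1/2\<rfloor>\<close>, so in both closures the maximum of \<open>x\<^sub>1\<close>
  drops to \<open>0\<close>, and no finite factor \<open>\<alpha>\<close> bridges the gap.\<close>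

section \<open>Orthant, polyhedra and convexity of the closures\<close>

lemma mem_nonneg_orthant_iff:
  "x \<in> nonneg_orthant n \<longleftrightarrow> x \<in> carrier_vec n \<and> (\<forall>j<n. 0 \<le> x $ j)"
  by (auto simp: nonneg_orthant_def less_eq_vec_def)

lemma row_real_mat: "i < dim_row A \<Longrightarrow> row (real_mat A) i = real_vec (row A i)"
  by (intro eq_vecI) auto

lemma mem_nonneg_polyhedron_iff:
  assumes "dim_vec b = dim_row A"
  shows "x \<in> nonneg_polyhedron A b \<longleftrightarrow> x \<in> nonneg_orthant (dim_col A) \<and>
    (\<forall>i<dim_row A. real_vec (row A i) \<bullet> x \<le> real_of_rat (b $ i))"
  using assms by (auto simp: nonneg_polyhedron_def less_eq_vec_def row_real_mat)

lemma convex_vec_nonneg_orthant: "convex_vec (nonneg_orthant n)"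
  by (auto simp: convex_vec_def mem_nonneg_orthant_iff)

lemma scalar_prod_convex_comb:
  fixes a x y :: "real vec"
  assumes "a \<in> carrier_vec n" "x \<in> carrier_vec n" "y \<in> carrier_vec n"
  shows "a \<bullet> (u \<cdot>\<^sub>v x + v \<cdot>\<^sub>v y) = u * (a \<bullet> x) + v * (a \<bullet> y)"
  using assms by (simp add: scalar_prod_add_distrib[of _ n])

text \<open>Half-spaces are convex. The rows of a polyhedron and the cuts of its CG closure are all
  of this kind, so the convexity of both sets reduces to this bound.\<close>

lemma scalar_prod_convex_comb_le:
  fixes a x y :: "real vec"
  assumes "a \<in> carrier_vec n" "x \<in> carrier_vec n" "y \<in> carrier_vec n"
    and "a \<bullet> x \<le> \<beta>" "a \<bullet> y \<le> \<beta>" "0 \<le> u" "0 \<le> v" "u + v = 1"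
  shows "a \<bullet> (u \<cdot>\<^sub>v x + v \<cdot>\<^sub>v y) \<le> \<beta>"
  using assms convex_bound_le[of "a \<bullet> x" \<beta> "a \<bullet> y" u v]
  by (simp add: scalar_prod_convex_comb[of _ n])

lemma convex_vec_nonneg_polyhedron:
  assumes "dim_vec b = dim_row A"
  shows "convex_vec (nonneg_polyhedron A b)"
  unfolding convex_vec_def
proof (intro ballI allI impI)
  fix x y and u v :: real
  assume xy: "x \<in> nonneg_polyhedron A b" "y \<in> nonneg_polyhedron A b"
    and uv: "0 \<le> u" "0 \<le> v" "u + v = 1"
  have "u \<cdot>\<^sub>v x + v \<cdot>\<^sub>v y \<in> nonneg_orthant (dim_col A)"
    using xy uv convex_vec_nonneg_orthant[of "dim_col A"]
    by (simp add: mem_nonneg_polyhedron_iff[OF assms] convex_vec_def)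
  then show "u \<cdot>\<^sub>v x + v \<cdot>\<^sub>v y \<in> nonneg_polyhedron A b"
    using xy uv
    by (auto simp: mem_nonneg_polyhedron_iff[OF assms] mem_nonneg_orthant_iff
        intro!: scalar_prod_convex_comb_le[of _ "dim_col A"])
qed

lemma convex_vec_cg_closure:
  assumes "dim_vec b = dim_row A"
  shows "convex_vec (cg_closure A b)"
  unfolding convex_vec_def
proof (intro ballI allI impI)
  fix x y and u v :: real
  assume xy: "x \<in> cg_closure A b" "y \<in> cg_closure A b"
    and uv: "0 \<le> u" "0 \<le> v" "u + v = 1"
  have "u \<cdot>\<^sub>v x + v \<cdot>\<^sub>v y \<in> nonneg_polyhedron A b"
    using xy uv convex_vec_nonneg_polyhedron[OF assms]
    by (simp add: cg_closure_def cg_closure_set_def convex_vec_def)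
  moreover have "x \<in> carrier_vec (dim_col A)" "y \<in> carrier_vec (dim_col A)"
    using xy by (simp_all add: cg_closure_def cg_closure_set_def
        mem_nonneg_polyhedron_iff[OF assms] mem_nonneg_orthant_iff)
  ultimately show "u \<cdot>\<^sub>v x + v \<cdot>\<^sub>v y \<in> cg_closure A b"
    using xy uv
    by (auto simp: cg_closure_def cg_closure_set_def
        intro!: scalar_prod_convex_comb_le[of _ "dim_col A"])
qed

lemma convex_vec_Inter:
  "(\<And>S. S \<in> F \<Longrightarrow> convex_vec S) \<Longrightarrow> convex_vec (\<Inter>F)"
  unfolding convex_vec_def by blast

text \<open>An intersection of hulls. Each hull is itself convex because convexity is stable under
  arbitrary intersections.\<close>

lemma convex_vec_aggregation_closure: "convex_vec (aggregation_closure A b)"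
proof -
  have "convex_vec (convex_vec hull S)" for S
    by (rule hull_in[where S = convex_vec]) (blast intro: convex_vec_Inter)
  then show ?thesis
    unfolding aggregation_closure_def by (blast intro: convex_vec_Inter)
qed

section \<open>Integral points of a polyhedron survive in both closures\<close>

text \<open>An integral \<open>a\<close> and an integral \<open>x\<close> have an integral product,
  so rounding the bound \<beta> down cannot cut \<open>x\<close> off.\<close>

lemma integral_point_in_cg_closure:
  assumes "x \<in> nonneg_polyhedron A b" "\<And>j. j < dim_col A \<Longrightarrow> x $ j \<in> \<int>"
  shows "x \<in> cg_closure A b"
proof -
  have x: "dim_vec x = dim_col A"
    using assms(1) by (auto simp: nonneg_polyhedron_def nonneg_orthant_def)
  have "map_vec real_of_int a \<bullet> x \<le> real_of_int \<lfloor>\<beta>\<rfloor>"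
    if "map_vec real_of_int a \<bullet> x \<le> \<beta>" "a \<in> carrier_vec (dim_col A)" for a \<beta>
  proof -
    have "map_vec real_of_int a \<bullet> x \<in> \<int>"
      using assms(2) x that(2) by (auto simp: scalar_prod_def intro!: Ints_sum Ints_mult)
    then show ?thesis
      using that(1) by (auto elim!: Ints_cases simp: le_floor_iff)
  qed
  then show ?thesis
    using assms(1) by (simp add: cg_closure_def cg_closure_set_def)
qed

text \<open>A nonnegative combination of the rows remains valid at \<open>x\<close>, so for each
  multiplier \<open>x\<close> is one of the points whose hull is taken.\<close>

lemma integral_point_in_aggregation_closure:
  assumes "dim_vec b = dim_row A"
    and "x \<in> nonneg_polyhedron A b" "\<And>j. j < dim_col A \<Longrightarrow> x $ j \<in> \<int>"
  shows "x \<in> aggregation_closure A b"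
proof -
  have "l \<bullet> (real_mat A *\<^sub>v x) \<le> l \<bullet> real_vec b" if "l \<in> nonneg_orthant (dim_row A)" for l
    using that assms(1,2) unfolding scalar_prod_def
    by (auto simp: mem_nonneg_polyhedron_iff mem_nonneg_orthant_iff row_real_mat
        intro!: sum_mono mult_left_mono)
  then show ?thesis
    using assms unfolding aggregation_closure_def
    by (auto simp: mem_nonneg_polyhedron_iff intro!: hull_inc)
qed

section \<open>Each closure lies in its 1-row closure\<close>

text \<open>The right-hand side has the form into which simp rewrites
  \<open>vec_of_list [\<beta>]\<close>.\<close>

lemma mem_single_row_polyhedron_iff:
  "x \<in> nonneg_polyhedron (mat_of_row a) (vCons \<beta> vNil) \<longleftrightarrow>
    x \<in> nonneg_orthant (dim_vec a) \<and> real_vec a \<bullet> x \<le> real_of_rat \<beta>"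
  by (subst mem_nonneg_polyhedron_iff) auto

text \<open>The CG closure is monotone: a single row describes a larger polyhedron, and every
  inequality valid for that one is valid for the original, hence yields the same cut.\<close>

lemma cg_closure_subset_one_row:
  assumes "dim_vec b = dim_row A"
  shows "cg_closure A b \<subseteq> one_row_closure cg_closure A b"
proof -
  have "cg_closure A b \<subseteq> cg_closure (mat_of_row (row A i)) (vec_of_list [b $ i])"
    if "i < dim_row A" for i
  proof -
    have "nonneg_polyhedron A b \<subseteq> nonneg_polyhedron (mat_of_row (row A i)) (vec_of_list [b $ i])"
      using that by (auto simp: mem_single_row_polyhedron_iff mem_nonneg_polyhedron_iff[OF assms])
    then show ?thesis
      unfolding cg_closure_def cg_closure_set_def by (auto simp: subset_iff)
  qed
  then show ?thesis
    by (auto simp: one_row_closure_def)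
qed

text \<open>Multipliers for row \<open>i\<close> alone are the multipliers for the whole system that
  vanish off \<open>i\<close>, so the 1-row closure intersects a subfamily of the same
  hulls.\<close>

lemma aggregation_closure_subset_one_row:
  assumes "dim_vec b = dim_row A"
  shows "aggregation_closure A b \<subseteq> one_row_closure aggregation_closure A b"
proof -
  have "aggregation_closure A b \<subseteq> aggregation_closure (mat_of_row (row A i)) (vec_of_list [b $ i])"
    if i: "i < dim_row A" for i
    unfolding aggregation_closure_def[of "mat_of_row _"]
  proof (rule INT_greatest)
    fix l assume "l \<in> nonneg_orthant (dim_row (mat_of_row (row A i)))"
    then have l: "dim_vec l = 1" "0 \<le> l $ 0"
      by (auto simp: mem_nonneg_orthant_iff)
    \<comment> \<open>The multiplier of the full system that aggregates to the same inequality as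
      \<open>l\<close> does for the single row.\<close>
    define k where "k = l $ 0 \<cdot>\<^sub>v unit_vec (dim_row A) i"
    have k: "k \<in> nonneg_orthant (dim_row A)"
      using l i by (auto simp: k_def mem_nonneg_orthant_iff unit_vec_def)
    have k_prod: "k \<bullet> w = l $ 0 * w $ i" if "w \<in> carrier_vec (dim_row A)" for w
      using that i unfolding k_def by (simp add: scalar_prod_left_unit)
    have l_prod: "l \<bullet> w = l $ 0 * w $ 0" if "dim_vec w = 1" for w
      using that by (simp add: scalar_prod_def)
    have lhs: "l \<bullet> (real_mat (mat_of_row (row A i)) *\<^sub>v x) = k \<bullet> (real_mat A *\<^sub>v x)" for x
      using i by (simp add: k_prod l_prod carrier_vecI row_real_mat)
    have rhs: "l \<bullet> real_vec (vec_of_list [b $ i]) = k \<bullet> real_vec b"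
    proof -
      have "real_vec b \<in> carrier_vec (dim_row A)"
        using assms by (intro carrier_vecI) simp
      then show ?thesis
        using i assms by (simp add: k_prod l_prod)
    qed
    show "aggregation_closure A b \<subseteq> convex_vec hull
        {x \<in> nonneg_orthant (dim_col (mat_of_row (row A i))).
          (\<forall>j < dim_col (mat_of_row (row A i)). x $ j \<in> \<int>) \<and>
          l \<bullet> (real_mat (mat_of_row (row A i)) *\<^sub>v x) \<le> l \<bullet> real_vec (vec_of_list [b $ i])}"
      using k unfolding lhs rhs aggregation_closure_def by auto
  qed
  then show ?thesis
    by (auto simp: one_row_closure_def)
qed

section \<open>The planar instance with a gap\<close>

definition gap_mat :: "rat mat" where
  "gap_mat = mat 2 2 (\<lambda>(i, j). if i = 0 \<and> j = 1 then - 1 else 1)"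

definition gap_vec :: "rat vec" where
  "gap_vec = vec 2 (\<lambda>i. if i = 0 then 0 else 1)"

lemma gap_dims [simp]:
  "dim_row gap_mat = 2" "dim_col gap_mat = 2" "dim_vec gap_vec = 2"
  by (simp_all add: gap_mat_def gap_vec_def)

lemma gap_vec_nth [simp]: "gap_vec $ 0 = 0" "gap_vec $ Suc 0 = 1"
  by (simp_all add: gap_vec_def)

lemma gap_rows:
  assumes "x \<in> carrier_vec 2"
  shows "real_vec (row gap_mat 0) \<bullet> x = x $ 0 - x $ 1"
    and "real_vec (row gap_mat (Suc 0)) \<bullet> x = x $ 0 + x $ 1"
  using assms by (auto simp: gap_mat_def scalar_prod_def numeral_2_eq_2)

lemma gap_cg_closure_le:
  assumes "x \<in> cg_closure gap_mat gap_vec"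
  shows "x \<in> carrier_vec 2 \<and> x $ 0 \<le> 0"
proof -
  \<comment> \<open>Adding the two rows eliminates the second coordinate.\<close>
  have P: "y \<in> carrier_vec 2" "y $ 0 \<le> 1 / 2" if "y \<in> nonneg_polyhedron gap_mat gap_vec" for y
    using that by (auto simp: mem_nonneg_polyhedron_iff mem_nonneg_orthant_iff gap_rows
        numeral_2_eq_2 All_less_Suc)
  have x: "x \<in> nonneg_polyhedron gap_mat gap_vec"
    using assms by (simp add: cg_closure_def cg_closure_set_def)
  have unit: "map_vec real_of_int (unit_vec 2 0) \<bullet> y = y $ 0" if "y \<in> carrier_vec 2" for y
    using that by (simp add: scalar_prod_def numeral_2_eq_2)
  have "map_vec real_of_int (unit_vec 2 0) \<bullet> x \<le> real_of_int \<lfloor>1 / 2 :: real\<rfloor>"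
  proof -
    have "\<forall>y\<in>nonneg_polyhedron gap_mat gap_vec.
        map_vec real_of_int (unit_vec 2 0) \<bullet> y \<le> 1 / 2"
      using P unit by metis
    moreover have "unit_vec 2 0 \<in> carrier_vec 2"
      by simp
    ultimately show ?thesis
      using assms unfolding cg_closure_def cg_closure_set_def gap_dims by blast
  qed
  then show ?thesis
    using P[OF x] unit[of x] by simp
qed

lemma gap_aggregation_closure_le:
  assumes "x \<in> aggregation_closure gap_mat gap_vec"
  shows "x \<in> carrier_vec 2 \<and> x $ 0 \<le> 0"
proof -
  \<comment> \<open>Equal weights cancel the second coordinate, leaving twice the first one, bounded
    by 1.\<close>
  define l where "l = vec 2 (\<lambda>_. 1 :: real)"
  have l: "l \<in> nonneg_orthant 2"
    by (simp add: l_def mem_nonneg_orthant_iff)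
  have Ax: "l \<bullet> (real_mat gap_mat *\<^sub>v x) = 2 * x $ 0" if "x \<in> carrier_vec 2" for x
    using that gap_rows[OF that] by (simp add: l_def row_real_mat scalar_prod_def[of "vec _ _"] numeral_2_eq_2)
  have b: "l \<bullet> real_vec gap_vec = 1"
    by (simp add: l_def scalar_prod_def numeral_2_eq_2)
  let ?H = "{x :: real vec. x \<in> carrier_vec 2 \<and> x $ 0 \<le> 0}"
  have "x \<in> convex_vec hull {x \<in> nonneg_orthant 2.
      (\<forall>j < 2. x $ j \<in> \<int>) \<and> l \<bullet> (real_mat gap_mat *\<^sub>v x) \<le> l \<bullet> real_vec gap_vec}"
    using assms l unfolding aggregation_closure_def by auto
  also have "\<dots> \<subseteq> ?H"
  \<comment> \<open>The half-space is convex, so the bound is needed only at integral points, where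
    \<open>2 * y $ 0 \<le> 1\<close> forces \<open>y $ 0 \<le> 0\<close>.\<close>
  proof (rule hull_minimal)
    show "convex_vec ?H"
      by (auto simp: convex_vec_def intro!: add_nonpos_nonpos mult_nonneg_nonpos)
    show "{x \<in> nonneg_orthant 2. (\<forall>j < 2. x $ j \<in> \<int>) \<and>
        l \<bullet> (real_mat gap_mat *\<^sub>v x) \<le> l \<bullet> real_vec gap_vec} \<subseteq> ?H"
    proof (clarsimp simp: b mem_nonneg_orthant_iff Ax)
      fix y :: "real vec"
      assume "\<forall>j<2. y $ j \<in> \<int>" and le: "2 * y $ 0 \<le> 1"
      then have "y $ 0 \<in> \<int>"
        by simp
      then obtain z where "y $ 0 = real_of_int z"
        by (rule Ints_cases)
      with le show "y $ 0 \<le> 0"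
        by simp
    qed
  qed
  finally show ?thesis by simp
qed

text \<open>For each row the point is the midpoint of two integral feasible points. Only convexity
  and the survival of integral points enter, so both operators are covered at once.\<close>

lemma half_in_one_row_closure:
  assumes convex: "\<And>A b. dim_vec b = dim_row A \<Longrightarrow> convex_vec (M A b)"
    and integral: "\<And>A b x. dim_vec b = dim_row A \<Longrightarrow> x \<in> nonneg_polyhedron A b \<Longrightarrow>
      (\<And>j. j < dim_col A \<Longrightarrow> x $ j \<in> \<int>) \<Longrightarrow> x \<in> M A b"
  shows "vec 2 (\<lambda>_. 1 / 2) \<in> one_row_closure M gap_mat gap_vec"
proof -
  have mid: "vec 2 (\<lambda>_. 1 / 2) \<in> M A b"
    if "dim_vec b = dim_row A" "dim_col A = 2"
      and "p \<in> nonneg_polyhedron A b" "q \<in> nonneg_polyhedron A b"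
      and "\<And>j. j < 2 \<Longrightarrow> p $ j \<in> \<int>" "\<And>j. j < 2 \<Longrightarrow> q $ j \<in> \<int>"
      and half: "vec 2 (\<lambda>_. 1 / 2) = (1 / 2) \<cdot>\<^sub>v p + (1 / 2) \<cdot>\<^sub>v q" for A b p q
  proof -
    have "p \<in> M A b" "q \<in> M A b"
      using that by (simp_all add: integral)
    moreover have "convex_vec (M A b)"
      using that(1) by (rule convex)
    ultimately show ?thesis
      unfolding half convex_vec_def by simp
  qed
  \<comment> \<open>Midpoint of (0,0) and (1,1), both tight for the first row.\<close>
  have "vec 2 (\<lambda>_. 1 / 2) \<in> M (mat_of_row (row gap_mat 0)) (vec_of_list [gap_vec $ 0])"
    by (rule mid[of _ _ "0\<^sub>v 2" "vec 2 (\<lambda>_. 1)"])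
      (auto simp: mem_single_row_polyhedron_iff mem_nonneg_orthant_iff gap_rows)
  \<comment> \<open>Midpoint of (1,0) and (0,1), both tight for the second row.\<close>
  moreover have "vec 2 (\<lambda>_. 1 / 2) \<in> M (mat_of_row (row gap_mat 1)) (vec_of_list [gap_vec $ 1])"
    by (rule mid[of _ _ "unit_vec 2 0" "unit_vec 2 1"])
      (auto simp: mem_single_row_polyhedron_iff mem_nonneg_orthant_iff gap_rows unit_vec_def)
  ultimately show ?thesis
    by (auto simp: one_row_closure_def numeral_2_eq_2 less_Suc_eq)
qed

theorem theorem2:
  fixes M :: "rat mat \<Rightarrow> rat vec \<Rightarrow> real vec set" and \<alpha> :: real
  assumes "M = aggregation_closure \<or> M = cg_closure"
    and "\<alpha> \<ge> 0"
  shows "\<exists>m n A b. m > 0 \<and> n > 0 \<and> A \<in> carrier_mat m n \<and> b \<in> carrier_vec m \<and>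
           M A b \<noteq> {} \<and> M A b \<subseteq> one_row_closure M A b \<and>
           \<not> is_approximation n \<alpha> (one_row_closure M A b) (M A b)"
proof -
  have convex: "convex_vec (M A b)" if "dim_vec b = dim_row A" for A b
    using assms(1) that convex_vec_cg_closure convex_vec_aggregation_closure by auto
  have integral: "x \<in> M A b" if "dim_vec b = dim_row A" "x \<in> nonneg_polyhedron A b"
    "\<And>j. j < dim_col A \<Longrightarrow> x $ j \<in> \<int>" for A b x
    using assms(1) that integral_point_in_cg_closure integral_point_in_aggregation_closure by auto
  have sub: "M gap_mat gap_vec \<subseteq> one_row_closure M gap_mat gap_vec"
    using assms(1) cg_closure_subset_one_row[of gap_vec gap_mat]
      aggregation_closure_subset_one_row[of gap_vec gap_mat] by fastforce
  have le: "x \<in> carrier_vec 2 \<and> x $ 0 \<le> 0" if "x \<in> M gap_mat gap_vec" for x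
    using assms(1) that gap_cg_closure_le gap_aggregation_closure_le by auto
  \<comment> \<open>The origin is integral and feasible, so the gap does not come from a supremum
    over the empty set.\<close>
  have "0\<^sub>v 2 \<in> M gap_mat gap_vec"
    by (rule integral)
      (auto simp: mem_nonneg_polyhedron_iff mem_nonneg_orthant_iff gap_rows numeral_2_eq_2
        less_Suc_eq)
  then have ne: "M gap_mat gap_vec \<noteq> {}" by blast
  have half: "vec 2 (\<lambda>_. 1 / 2) \<in> one_row_closure M gap_mat gap_vec"
    using half_in_one_row_closure convex integral by blast
  let ?c = "unit_vec 2 0 :: real vec"
  have "\<not> is_approximation 2 \<alpha> (one_row_closure M gap_mat gap_vec) (M gap_mat gap_vec)"
  proof
    assume "is_approximation 2 \<alpha> (one_row_closure M gap_mat gap_vec) (M gap_mat gap_vec)"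
    moreover have "?c \<in> nonneg_orthant 2"
      by (simp add: mem_nonneg_orthant_iff unit_vec_def)
    ultimately have "(SUP x\<in>one_row_closure M gap_mat gap_vec. ereal (?c \<bullet> x)) \<le>
        ereal \<alpha> * (SUP x\<in>M gap_mat gap_vec. ereal (?c \<bullet> x))"
      by (simp add: is_approximation_def)
    \<comment> \<open>Since \<alpha> is nonnegative, multiplying by it preserves the bound 0, while
      the objective is 1/2 at the surviving point.\<close>
    also have "\<dots> \<le> ereal \<alpha> * 0"
    proof (rule ereal_mult_left_mono)
      show "(SUP x\<in>M gap_mat gap_vec. ereal (?c \<bullet> x)) \<le> 0"
        using le by (intro SUP_least) (auto simp: scalar_prod_left_unit)
    qed (use assms(2) in simp)
    finally have "ereal (?c \<bullet> vec 2 (\<lambda>_. 1 / 2)) \<le> 0"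
      using half by (auto simp: SUP_le_iff)
    then show False
      by (simp add: scalar_prod_left_unit)
  qed
  moreover have "gap_mat \<in> carrier_mat 2 2" "gap_vec \<in> carrier_vec 2"
    by (auto intro: carrier_matI carrier_vecI)
  ultimately show ?thesis
    using sub ne by (intro exI[of _ 2] exI[of _ gap_mat] exI[of _ gap_vec]) auto
qed

end
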